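(* Let $m$ and $t$ be integers satisfying $$\binom{t-1}{3} \le m \le \binom{t-1}{3} + \binom{t-2}{2} - \frac{1}{2}(t-1).$$ Let $G$ be a $3$-uniform hypergraph with $m$ edges which does not contain a clique of order $t-1$. Then $\lambda(G)<\lambda([t-1]^{(3)})$.
   Context: A $3$-uniform hypergraph ($3$-graph) $G$ consists of a finite vertex set $V(G)$ and an edge set $E(G)\subseteq V(G)^{(3)}$, the family of $3$-element subsets of $V(G)$. A clique of order $s$ in $G$ is a set of $s$ vertices all of whose $3$-subsets are edges of $G$. For $n\in\mathbb N$, $[n]=\{1,\dots,n\}$ and $[n]^{(3)}$ denotes the complete $3$-graph on vertex set $[n]$. For a $3$-graph $G$ on vertex set $[n]$ and $\vec x=(x_1,\dots,x_n)\in\mathbb R^n$, let $\lambda(G,\vec x)=\sum_{ijk\in E(G)}x_ix_jx_k$, and the Lagrangian of $G$ is $\lambda(G)=\max\{\lambda(G,\vec x): \sum_{i=1}^n x_i=1,\ x_i\ge 0\}$. (In particular $\lambda([t-1]^{(3)})=\binom{t-1}{3}/(t-1)^3$.) *)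

theory Defs
  imports "HOL-Analysis.Analysis" "HOL-Library.Ramsey"
begin

text \<open>
  A 3-graph is given by its vertex set \<open>V\<close> and its edge set \<open>E\<close>. The library notation
  \<open>[A]\<^bsup>k\<^esup>\<close> (\<^const>\<open>nsets\<close>) stands for the set of all \<open>k\<close>-element subsets of \<open>A\<close>.
\<close>

definition three_graph :: "'a set \<Rightarrow> 'a set set \<Rightarrow> bool" where
  "three_graph V E \<longleftrightarrow> finite V \<and> E \<subseteq> [V]\<^bsup>3\<^esup>"

definition clique3 :: "'a set \<Rightarrow> 'a set set \<Rightarrow> nat \<Rightarrow> 'a set \<Rightarrow> bool" where
  "clique3 V E s K \<longleftrightarrow> K \<in> [V]\<^bsup>s\<^esup> \<and> [K]\<^bsup>3\<^esup> \<subseteq> E"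

definition lagrange_poly :: "'a set set \<Rightarrow> ('a \<Rightarrow> real) \<Rightarrow> real" where
  "lagrange_poly E x = (\<Sum>e\<in>E. \<Prod>i\<in>e. x i)"

definition weightings :: "'a set \<Rightarrow> ('a \<Rightarrow> real) set" where
  "weightings V = {x. (\<forall>i\<in>V. 0 \<le> x i) \<and> (\<Sum>i\<in>V. x i) = 1}"

text \<open>
  Values of a weighting outside \<open>V\<close> are irrelevant. The supremum is a maximum whenever
  \<open>V\<close> is nonempty, see \<open>lagrangian_attained\<close> below; for empty \<open>V\<close> it is unspecified.
\<close>

definition lagrangian :: "'a set \<Rightarrow> 'a set set \<Rightarrow> real" where
  "lagrangian V E = (SUP x\<in>weightings V. lagrange_poly E x)"

lemma lagrangian_attained:
  assumes G: "three_graph V E" and "V \<noteq> {}"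
  shows "\<exists>x\<in>weightings V. lagrange_poly E x = lagrangian V E \<and>
           (\<forall>y\<in>weightings V. lagrange_poly E y \<le> lagrange_poly E x)"
proof -
  have fin: "finite V" and E: "\<And>e. e \<in> E \<Longrightarrow> e \<subseteq> V"
    using G by (auto simp: three_graph_def nsets_def)
  define B :: "('a \<Rightarrow> real) set" where "B = PiE UNIV (\<lambda>i. if i \<in> V then {0..1} else {0})"
  define S where "S = B \<inter> {x. (\<Sum>i\<in>V. x i) = 1}"
  have "compactin (product_topology (\<lambda>i. euclidean) UNIV) B"
    unfolding B_def by (subst compactin_PiE) auto
  then have "compact B"
    by (simp add: euclidean_product_topology)
  moreover have "closed {x :: 'a \<Rightarrow> real. (\<Sum>i\<in>V. x i) = 1}"
    by (intro closed_Collect_eq continuous_intros continuous_on_product_coordinates)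
  ultimately have "compact S"
    unfolding S_def by (rule compact_Int_closed)
  obtain v where "v \<in> V" using assms by auto
  then have "(\<lambda>i. if i = v then 1 else 0) \<in> S"
    using fin by (auto simp: S_def B_def)
  then have "S \<noteq> {}" by auto
  have "continuous_on S (lagrange_poly E)"
    unfolding lagrange_poly_def
    by (intro continuous_intros continuous_on_subset[OF continuous_on_product_coordinates]) auto
  then obtain x where x: "x \<in> S" "\<And>y. y \<in> S \<Longrightarrow> lagrange_poly E y \<le> lagrange_poly E x"
    using continuous_attains_sup[OF \<open>compact S\<close> \<open>S \<noteq> {}\<close>] by blast
  have xw: "x \<in> weightings V"
    using x(1) unfolding S_def B_def weightings_def
    by (auto simp: PiE_iff split: if_splits)
  have le: "lagrange_poly E y \<le> lagrange_poly E x" if y: "y \<in> weightings V" for y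
  proof -
    define z where "z = (\<lambda>i. if i \<in> V then y i else 0)"
    have "y i \<le> 1" if "i \<in> V" for i
      using member_le_sum[of i V y] y fin that by (auto simp: weightings_def)
    moreover have "sum z V = 1" using y by (simp add: z_def weightings_def)
    ultimately have "z \<in> S"
      using y by (auto simp: S_def B_def z_def weightings_def)
    moreover have "lagrange_poly E z = lagrange_poly E y"
      unfolding lagrange_poly_def z_def
      by (intro sum.cong prod.cong refl) (use E in auto)
    ultimately show ?thesis using x(2)[of z] by simp
  qed
  have "lagrangian V E = lagrange_poly E x"
    unfolding lagrangian_def using xw le by (intro cSup_eq_maximum) auto
  then show ?thesis using xw le by metis
qed

end

theory Submission
  imports Defs
begin

text \<open>
  Put \<open>n = t - 1\<close>; for \<open>n < 4\<close> the hypotheses are contradictory. Take a maximising weighting \<open>x\<close> with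
  support \<open>S\<close>, let \<open>\<lambda>\<close> be the Lagrangian and \<open>a\<close> the largest weight. For every vertex of \<open>S\<close> the
  link has weight \<open>3\<lambda>\<close>. Comparing with the complete link of a heaviest vertex gives
  \<open>6\<lambda> \<le> (1 - a)\<^sup>2 - \<Sum>x\<^sub>i\<^sup>2\<close> (sum over the other vertices), which settles \<open>card S < n\<close>; for
  \<open>card S = n\<close> an edge is missing in \<open>S\<close>.

  Summing all links and using \<open>pq + pr + qr - (2/a)pqr \<le> a\<^sup>2\<close> on \<open>[0, a]\<close> gives
  \<open>\<lambda>(3 card S - 2/a) \<le> m a\<^sup>2\<close>. If \<open>card S \<ge> n + 2\<close>, the two bounds exclude
  \<open>\<lambda> \<ge> (n - 1)(n - 2)/(6n\<^sup>2)\<close>.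

  If \<open>card S = n + 1\<close>, merge the two lightest vertices \<open>u, v\<close>. This turns the complete 3-graph without the
  edges through \<open>u, v\<close> into the complete 3-graph on \<open>n\<close> vertices, so that \<open>\<lambda>\<close> exceeds
  \<open>(n - 1)(n - 2)/(6n\<^sup>2)\<close> by at most \<open>x\<^sub>u x\<^sub>v\<close> times the weight of the \<open>b\<close> vertices that form an edge with
  \<open>u, v\<close>, minus the weight of the at least \<open>b + n/2\<close> missing edges not through both \<open>u\<close> and \<open>v\<close>. The
  first bound shows that the fourth smallest weight is more than about \<open>2a/3\<close>, hence the missing edges win.
\<close>

section \<open>Real inequalities\<close>

text \<open>
  Here \<open>k\<close> is the size of the support and \<open>c = n a\<close> the normalised largest weight. At \<open>c = 1\<close> the
  hypotheses \<open>i\<close> and \<open>ii\<close> admit exactly \<open>n \<le> k \<le> n + 1\<close>, so there is little room for estimates when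
  \<open>k = n + 2\<close>.
\<close>

lemma large_support_inequalities_contradictory:
  fixes n k c :: real
  assumes n: "n = 4 \<or> n \<ge> 5" and k: "k \<ge> n + 2" and c: "0 < c" "c \<le> n"
    and i: "3 * k * c \<le> (n + 3) * c ^ 3 + 2 * n"
    and ii: "(n - 1) * (n - 2) * (k - 1) \<le> (n - c)\<^sup>2 * (k - 2)"
    and iii: "n \<le> k * c"
  shows False
proof (cases "c \<le> 1")
  case True
  have "k * c \<le> (n + 3) * c ^ 3" using i iii by simp
  then have "k \<le> (n + 3) * c\<^sup>2"
    using c by (simp add: power2_eq_square power3_eq_cube flip: mult.assoc)
  moreover have "c\<^sup>2 \<le> c" using c True by (simp add: power2_eq_square mult_left_le)
  then have "(n + 3) * c\<^sup>2 \<le> (n + 3) * c" using n by (intro mult_left_mono) auto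
  ultimately have g: "(n + 3) * (1 - c) \<le> 1" using k by (simp add: algebra_simps)
  \<comment> \<open>The deficit \<open>g\<close> of \<open>c\<close> below 1 is at most 1/(n+3). In
    terms of \<open>g\<close>, hypothesis \<open>i\<close> with \<open>k\<close> lowered to n+2
    becomes a cubic whose value is then at most -3.\<close>
  define g where "g = 1 - c"
  have g0: "g \<ge> 0" "g \<le> 1" using True c by (auto simp: g_def)
  have "(n + 3) * g * g \<le> 1 * g" using g g0 unfolding g_def by (intro mult_right_mono) auto
  moreover have "(n + 3) * g ^ 3 \<ge> 0" using n g0 by auto
  moreover have "3 * (n + 2) * c \<le> 3 * k * c" using k c by (intro mult_right_mono) auto
  then have "(n + 3) * c ^ 3 + 2 * n - 3 * (n + 2) * c \<ge> 0" using i by linarith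
  moreover have "(n + 3) * c ^ 3 + 2 * n - 3 * (n + 2) * c
      = - 3 - 3 * g + 3 * ((n + 3) * g * g) - (n + 3) * g ^ 3"
    by (simp add: g_def power3_eq_cube algebra_simps)
  ultimately show False using g0 by linarith
next
  case False
  define b where "b = c - 1"
  define N where "N = n - 1"
  have b0: "b > 0" using False by (simp add: b_def)
  have N3: "N \<ge> 3" using n by (auto simp: N_def)
  \<comment> \<open>\<open>K3\<close> is the upper bound on 3kc from \<open>i\<close>, and
    \<open>br\<close> is the coefficient of \<open>k\<close> once \<open>ii\<close> is collected in
    powers of \<open>k\<close>. As \<open>br\<close> turns out nonnegative, the two bounds combine
    and \<open>k\<close> is eliminated; the result is the polynomial inequality \<open>F\<close> in
    \<open>N\<close> and \<open>b\<close>.\<close>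
  define K3 where "K3 = 3 * N + 6 + (N + 4) * (3 * b + 3 * b^2 + b^3)"
  define br where "br = N * (1 - 2 * b) + b\<^sup>2"
  have K3: "3 * k * c \<le> K3"
    using i unfolding K3_def b_def N_def by (simp add: power2_eq_square power3_eq_cube algebra_simps)
  have "3 * (n + 2) * c \<le> 3 * k * c" using k c by (intro mult_right_mono) auto
  then have lb: "3 \<le> 3 * b + (N + 4) * (3 * b\<^sup>2 + b ^ 3)"
    using i unfolding b_def N_def by (simp add: power2_eq_square power3_eq_cube algebra_simps)
  \<comment> \<open>Needed because \<open>F\<close> holds for \<open>b\<close> near 0, where the
    term 3N dominates; \<open>i\<close> together with n + 2 <= k excludes such small
    \<open>b\<close>.\<close>
  have bn: "b \<ge> 1 / (N + 1)"
  proof (rule ccontr)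
    assume neg: "\<not> ?thesis"
    define z where "z = 1 / (N + 1)"
    have z: "0 < z" "z \<le> 1 / 4" using N3 by (auto simp: z_def field_simps)
    have bz: "b < z" using neg by (simp add: z_def)
    have sq: "b\<^sup>2 \<le> z\<^sup>2" "b ^ 3 \<le> z ^ 3" using bz b0 by (auto intro!: power_mono)
    have "(N + 4) * (3 * b\<^sup>2 + b ^ 3) \<le> (N + 4) * (3 * z\<^sup>2 + z ^ 3)"
      using sq N3 by (intro mult_left_mono) auto
    also have "\<dots> = ((N + 1) * z + 3 * z) * (3 * z + z\<^sup>2)"
      by (simp add: power2_eq_square power3_eq_cube algebra_simps)
    also have "(N + 1) * z = 1" using N3 by (simp add: z_def)
    also have "(1 + 3 * z) * (3 * z + z\<^sup>2) \<le> (1 + 3 * (1/4)) * (3 * (1/4) + (1/4)\<^sup>2)"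
      using z by (intro mult_mono add_mono power_mono) auto
    finally show False using lb bz z by (simp add: power2_eq_square)
  qed
  have ii': "k * br \<ge> N * (N + 1) - 4 * N * b + 2 * b\<^sup>2"
    using ii unfolding br_def b_def N_def by (simp add: power2_eq_square algebra_simps)
  have "br \<ge> 0"
  proof (rule ccontr)
    assume "\<not> ?thesis"
    then have "(n - c)\<^sup>2 < (n - 1) * (n - 2)"
      unfolding br_def b_def N_def by (simp add: power2_eq_square algebra_simps)
    then have "(n - c)\<^sup>2 * (k - 2) < (n - 1) * (n - 2) * (k - 2)"
      using k n by (intro mult_strict_right_mono) auto
    also have "\<dots> \<le> (n - 1) * (n - 2) * (k - 1)" using n by (intro mult_left_mono) auto
    finally show False using ii by simp
  qed
  have b1: "b \<le> 1"
  proof (rule ccontr)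
    assume neg: "\<not> ?thesis"
    have "b * b \<le> N * b" using b0 c by (intro mult_right_mono) (auto simp: b_def N_def)
    then have "br \<le> N * (1 - b)" unfolding br_def by (simp add: power2_eq_square algebra_simps)
    also have "\<dots> < 0" using neg N3 by (simp add: mult_less_0_iff)
    finally show False using \<open>br \<ge> 0\<close> by simp
  qed
  have "3 * c * (N * (N + 1) - 4 * N * b + 2 * b\<^sup>2) \<le> 3 * c * (k * br)"
    using ii' c by (intro mult_left_mono) auto
  also have "\<dots> = 3 * k * c * br" by simp
  also have "\<dots> \<le> K3 * br" using K3 \<open>br \<ge> 0\<close> by (intro mult_right_mono) auto
  finally have F: "0 \<le> K3 * br - 3 * (1 + b) * (N * (N + 1) - 4 * N * b + 2 * b\<^sup>2)"
    by (simp add: b_def)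
  also have "\<dots> = N * N * (- 6 * b - 3 * b^2 - 5 * b^3 - 2 * b^4)
      + N * (3 + 9 * b + 3 * b^2 - 17 * b^3 - 5 * b^4 + b^5) + (6 * b^3 + 12 * b^4 + 4 * b^5)"
    unfolding K3_def br_def by algebra
  also have "\<dots> = N * (N * (- 6 * b - 3 * b^2 - 5 * b^3 - 2 * b^4)
      + (3 + 9 * b + 3 * b^2 - 17 * b^3 - 5 * b^4 + b^5)) + (6 * b^3 + 12 * b^4 + 4 * b^5)"
    by (simp add: algebra_simps)
  \<comment> \<open>By 3 <= N the part free of \<open>N\<close> is absorbed, so that a factor
    \<open>N\<close> can be cancelled.\<close>
  also have "\<dots> \<le> N * (N * (- 6 * b - 3 * b^2 - 5 * b^3 - 2 * b^4)
      + (3 + 9 * b + 3 * b^2 - 17 * b^3 - 5 * b^4 + b^5)) + N / 3 * (6 * b^3 + 12 * b^4 + 4 * b^5)"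
  proof -
    have "1 * (6 * b^3 + 12 * b^4 + 4 * b^5) \<le> N / 3 * (6 * b^3 + 12 * b^4 + 4 * b^5)"
      using b0 N3 by (intro mult_right_mono) auto
    then show ?thesis by simp
  qed
  also have "\<dots> = N * (N * (- 6 * b - 3 * b^2 - 5 * b^3 - 2 * b^4)
      + (3 + 9 * b + 3 * b^2 - 15 * b^3 - b^4 + 7 / 3 * b^5))"
    by (simp add: algebra_simps)
  finally have G: "0 \<le> N * (- 6 * b - 3 * b^2 - 5 * b^3 - 2 * b^4)
      + (3 + 9 * b + 3 * b^2 - 15 * b^3 - b^4 + 7 / 3 * b^5)"
    using N3 by (simp add: zero_le_mult_iff)
  have b54: "b ^ 5 \<le> b ^ 4" using b0 b1 by (intro power_decreasing) auto
  have b4: "b ^ 4 \<ge> 0" "b ^ 3 \<ge> 0" "b\<^sup>2 \<ge> 0" using b0 by auto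
  have pN: "N * b\<^sup>2 \<ge> 3 * b\<^sup>2" "N * b ^ 3 \<ge> 3 * b ^ 3" "N * b ^ 4 \<ge> 3 * b ^ 4"
    using N3 b4 by (intro mult_right_mono; simp)+
  have H: "0 \<le> 3 + 9 * b - 6 * (N * b) - 6 * b\<^sup>2 - 30 * b ^ 3"
  proof -
    have "N * (- 6 * b - 3 * b^2 - 5 * b^3 - 2 * b^4)
        = - 6 * (N * b) - 3 * (N * b\<^sup>2) - 5 * (N * b ^ 3) - 2 * (N * b ^ 4)"
      by (simp add: algebra_simps)
    then show ?thesis using G b54 pN b4 by linarith
  qed
  \<comment> \<open>From 4 <= N on, the linear terms of \<open>H\<close> sum to at most 12b - 3Nb <=
    0. For N = 3 this would leave 3b over, so the square and the cube of \<open>b\<close> are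
    evaluated too.\<close>
  show False
  proof (cases "N = 3")
    case True
    then have "b \<ge> 1 / 4" using bn by simp
    then have "b\<^sup>2 \<ge> (1/4)\<^sup>2" "b ^ 3 \<ge> (1/4) ^ 3" by (auto intro!: power_mono)
    then show False using H True \<open>b \<ge> 1/4\<close> by (simp add: power2_eq_square power3_eq_cube)
  next
    case False
    then have N4: "N \<ge> 4" using n by (auto simp: N_def)
    have "1 \<le> (N + 1) * b" using bn N4 by (simp add: field_simps)
    moreover have "4 * b \<le> N * b" using N4 b0 by (intro mult_right_mono) auto
    moreover have "b\<^sup>2 > 0" using b0 by simp
    ultimately show False using H b4 by (simp add: algebra_simps)
  qed
qed

text \<open>
  If four of the \<open>n + 1\<close> weights are at most \<open>(1 - h)a\<close>, then \<open>lo\<close> and \<open>dev\<close> bound the first and second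
  moment of the deviations \<open>a - x\<^sub>i\<close>. The factor \<open>1 - h = (2n - 2)/(3n - 2)\<close> is \<open>b/(b + n/2)\<close> for the
  largest possible \<open>b = n - 1\<close> of the merging argument.
\<close>

lemma small_weights_inequalities_contradictory:
  fixes n a :: real
  defines "h \<equiv> n / (3 * n - 2)"
  assumes n: "n = 4 \<or> n \<ge> 5"
    and lo: "4 * h * a \<le> (n + 1) * a - 1"
    and qm: "(n - 2) / n \<le> (1 - a)\<^sup>2" and a: "0 \<le> a" "a \<le> 1"
    and dev: "4 * h\<^sup>2 * a\<^sup>2 \<le> 1 - 4 * a + (n + 3) * a\<^sup>2 - (n - 1) * (n - 2) / n\<^sup>2"
  shows False
proof -
  have h: "h > 1 / 3" "h \<le> 2 / 5" using n unfolding h_def by (auto simp: field_simps)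
  have h2: "h\<^sup>2 \<ge> 1 / 9" using power_mono[of "1/3" h 2] h by (simp add: power2_eq_square)
  \<comment> \<open>\<open>a0\<close> is the least \<open>a\<close> that \<open>lo\<close> permits,
    and \<open>dev\<close> says that the quadratic \<open>P\<close> is nonnegative at
    \<open>a\<close>. The bound on \<open>a\<close> from \<open>qm\<close> gives P(a) <= P(a0), so
    it suffices that P(a0) < 0.\<close>
  define a0 where "a0 = 1 / (n + 1 - 4 * h)"
  have den: "n + 1 - 4 * h > 0" using n h by auto
  have a0a: "a0 \<le> a" using lo den unfolding a0_def by (simp add: field_simps)
  define A where "A = n + 3 - 4 * h\<^sup>2"
  define P where "P = (\<lambda>a. A * a\<^sup>2 - 4 * a + (1 - (n - 1) * (n - 2) / n\<^sup>2))"
  have Pa: "P a \<ge> 0" using dev by (simp add: P_def A_def algebra_simps)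
  have a32: "a \<le> 3 / 2 / (n + 1)"
  proof (rule ccontr)
    assume "\<not> ?thesis"
    then have "(1 - a)\<^sup>2 \<le> (1 - 3 / 2 / (n + 1))\<^sup>2" using a by (intro power_mono) auto
    moreover have "(1 - 3 / 2 / (n + 1))\<^sup>2 < (n - 2) / n"
    proof -
      have "(n - 1/2)\<^sup>2 * n < (n - 2) * (n + 1)\<^sup>2"
      proof -
        have "n * 4 \<le> n * n" using n by (intro mult_left_mono) auto
        moreover have "n \<ge> 4" using n by auto
        moreover have "(n - 2) * (n + 1)\<^sup>2 - (n - 1/2)\<^sup>2 * n = n * n - 13 / 4 * n - 2"
          by (simp add: power2_eq_square algebra_simps)
        ultimately show ?thesis by linarith
      qed
      moreover have "1 - 3 / 2 / (n + 1) = (n - 1/2) / (n + 1)"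
      proof -
        have "n > 0" using n by auto
        then show ?thesis by (simp add: field_simps)
      qed
      moreover have "n > 0" "(n + 1)\<^sup>2 > 0" using n by auto
      ultimately show ?thesis
        by (simp add: power_divide pos_divide_less_eq pos_less_divide_eq del: zero_less_power2)
    qed
    ultimately show False using qm by simp
  qed
  have "A * (a + a0) \<le> (n + 23 / 9) * (2 * (3 / 2 / (n + 1)))"
    using h2 a32 a0a den a n by (intro mult_mono) (auto simp: A_def a0_def)
  also have "\<dots> \<le> 4" using n by (auto simp: field_simps)
  finally have "(a - a0) * (A * (a + a0) - 4) \<le> 0"
    using a0a by (simp add: mult_nonneg_nonpos)
  moreover have "P a - P a0 = (a - a0) * (A * (a + a0) - 4)"
    by (simp add: P_def power2_eq_square algebra_simps)
  ultimately have P0: "P a0 \<ge> 0" using Pa by simp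
  have hq: "h * (3 * n - 2) = n" using n by (auto simp: h_def)
  \<comment> \<open>Since h = n/q, the denominator of \<open>a0\<close> is D/q. Multiplying P(a0) by
    the squares of \<open>n\<close> and \<open>D\<close> leaves a polynomial in \<open>n\<close>,
    which is -24 at n = 4.\<close>
  define D where "D = 3 * n\<^sup>2 - 3 * n - 2"
  define q where "q = 3 * n - 2"
  have q0: "q > 0" using n by (auto simp: q_def)
  have "4 * n \<le> n * n" using n by (intro mult_right_mono) auto
  then have D0: "D > 0" using n unfolding D_def power2_eq_square by linarith
  have "(n + 1 - 4 * h) * q = D"
    using hq by (simp add: D_def q_def power2_eq_square algebra_simps)
  then have a0q: "a0 = q / D" using q0 D0 den unfolding a0_def by (simp add: field_simps)
  have "n\<^sup>2 * D\<^sup>2 * P a0 = n\<^sup>2 * ((n + 3) * q\<^sup>2 - 4 * (h * q)\<^sup>2) - 4 * n\<^sup>2 * q * D + q * D\<^sup>2"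
  proof -
    have n0: "n \<noteq> 0" using n by auto
    have e: "n\<^sup>2 * (1 - (n - 1) * (n - 2) / n\<^sup>2) = q"
      using n0 by (simp add: q_def field_simps power2_eq_square)
    have "n\<^sup>2 * D\<^sup>2 * P a0 = n\<^sup>2 * (A * (D * a0)\<^sup>2) - 4 * n\<^sup>2 * D * (D * a0)
        + n\<^sup>2 * (1 - (n - 1) * (n - 2) / n\<^sup>2) * D\<^sup>2"
      by (simp add: P_def algebra_simps power2_eq_square)
    also have "D * a0 = q" using a0q D0 by simp
    finally show ?thesis unfolding e A_def by (simp add: algebra_simps power2_eq_square)
  qed
  also have "h * q = n" using hq by (simp add: q_def)
  also have "n\<^sup>2 * ((n + 3) * q\<^sup>2 - 4 * n\<^sup>2) - 4 * n\<^sup>2 * q * D + q * D\<^sup>2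
      = n\<^sup>2 * (38 - n * (n + 5)) - 12 * n - 8"
    unfolding q_def D_def by algebra
  also have "\<dots> < 0"
  proof (cases "n = 4")
    case False
    then have "n \<ge> 5" using n by simp
    then have "n * (n + 5) \<ge> 5 * (5 + 5)" by (intro mult_mono) auto
    then have "n\<^sup>2 * (38 - n * (n + 5)) \<le> 0" by (intro mult_nonneg_nonpos) auto
    then show ?thesis using \<open>n \<ge> 5\<close> by linarith
  qed simp
  finally show False using P0 by (simp add: mult_less_0_iff)
qed

text \<open>Bounds the contribution of one edge when all links are summed. Equality holds as soon as
  two of the three weights equal \<open>a\<close>, which explains the coefficient 2/a.\<close>

lemma pairwise_products_minus_triple_product_le:
  fixes p q r a :: real
  assumes "0 < p" "p \<le> a" "0 < q" "q \<le> a" "0 < r" "r \<le> a"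
  shows "p * q + p * r + q * r - 2 / a * (p * q * r) \<le> a\<^sup>2"
proof -
  have a: "a > 0" using assms by linarith
  have "0 \<le> (a - p) * (a - q) * r + (a - p) * (a - r) * q + a * (a - q) * (a - r)"
    using assms a by (intro add_nonneg_nonneg mult_nonneg_nonneg) auto
  also have "\<dots> = a * (a\<^sup>2 - (p * q + p * r + q * r - 2 / a * (p * q * r)))"
    using a by (simp add: field_simps power2_eq_square)
  finally show ?thesis using a by (simp add: zero_le_mult_iff)
qed

text \<open>After cross-multiplication the difference factors as (n - k)(3kn - 2(n + k)). For k = 1
  and n = 2 both values are 0, so \<open>n\<close> has to be bounded below.\<close>

lemma complete_lagrangian_value_strict_mono:
  fixes k n :: real
  assumes "1 \<le> k" "k < n" "4 \<le> n"
  shows "(k - 1) * (k - 2) / (6 * k\<^sup>2) < (n - 1) * (n - 2) / (6 * n\<^sup>2)"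
proof -
  have "2 * (n + k) < 3 * k * n"
  proof -
    have "(3 * k - 2) * 4 \<le> (3 * k - 2) * n" using assms by (intro mult_left_mono) auto
    then show ?thesis using assms by (simp add: algebra_simps)
  qed
  then have "0 < (n - k) * (3 * k * n - 2 * (n + k))" using assms by simp
  then have "(k - 1) * (k - 2) * n\<^sup>2 < (n - 1) * (n - 2) * k\<^sup>2"
    by (simp add: power2_eq_square algebra_simps)
  then show ?thesis using assms by (simp add: field_simps)
qed

section \<open>Links and weightings of maximal value\<close>

text \<open>Kept as a set system, so that \<open>lagrange_poly\<close> applies to it and yields the
  partial derivative of the polynomial in the direction of \<open>j\<close>.\<close>

definition link :: "'a \<Rightarrow> 'a set set \<Rightarrow> 'a set set" where
  "link j E = (\<lambda>e. e - {j}) ` {e \<in> E. j \<in> e}"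

lemma lagrange_poly_link:
  "lagrange_poly (link j E) x = (\<Sum>e | e \<in> E \<and> j \<in> e. \<Prod>i\<in>e - {j}. x i)"
proof -
  have "inj_on (\<lambda>e. e - {j}) {e \<in> E. j \<in> e}" by (rule inj_onI) auto
  then show ?thesis unfolding lagrange_poly_def link_def by (simp add: sum.reindex)
qed

lemma weight_times_link:
  assumes "\<And>e. e \<in> E \<Longrightarrow> finite e"
  shows "x j * lagrange_poly (link j E) x = (\<Sum>e | e \<in> E \<and> j \<in> e. \<Prod>i\<in>e. x i)"
  unfolding lagrange_poly_link sum_distrib_left
  using assms by (intro sum.cong) (auto simp: prod.remove)

lemma lagrange_poly_split:
  assumes "finite E" "\<And>e. e \<in> E \<Longrightarrow> finite e"
  shows "lagrange_poly E x = lagrange_poly {e \<in> E. j \<notin> e} x + x j * lagrange_poly (link j E) x"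
proof -
  have "E = {e \<in> E. j \<notin> e} \<union> {e \<in> E. j \<in> e}" by auto
  then have "lagrange_poly E x = lagrange_poly ({e \<in> E. j \<notin> e} \<union> {e \<in> E. j \<in> e}) x" by simp
  also have "\<dots> = lagrange_poly {e \<in> E. j \<notin> e} x + lagrange_poly {e \<in> E. j \<in> e} x"
    unfolding lagrange_poly_def using assms(1) by (intro sum.union_disjoint) auto
  finally show ?thesis using weight_times_link[OF assms(2)] by (simp add: lagrange_poly_def)
qed

lemma lagrange_poly_scale:
  assumes "\<And>e. e \<in> E \<Longrightarrow> card e = k" "\<And>e i. e \<in> E \<Longrightarrow> i \<in> e \<Longrightarrow> y i = c * x i"
  shows "lagrange_poly E y = c ^ k * lagrange_poly E x"
proof -
  have "(\<Prod>i\<in>e. y i) = c ^ k * (\<Prod>i\<in>e. x i)" if "e \<in> E" for e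
  proof -
    have "(\<Prod>i\<in>e. y i) = (\<Prod>i\<in>e. c * x i)" using that assms(2) by (intro prod.cong) auto
    then show ?thesis using that assms(1) by (simp add: prod.distrib)
  qed
  then show ?thesis by (simp add: lagrange_poly_def sum_distrib_left)
qed

text \<open>On all k-subsets \<open>lagrange_poly\<close> is the k-th elementary symmetric
  polynomial; this is its Pascal-type recursion.\<close>

lemma lagrange_poly_nsets_insert:
  assumes "finite A" "a \<notin> A"
  shows "lagrange_poly ([insert a A]\<^bsup>Suc k\<^esup>) x = lagrange_poly ([A]\<^bsup>Suc k\<^esup>) x + x a * lagrange_poly ([A]\<^bsup>k\<^esup>) x"
proof -
  have "{e \<in> [insert a A]\<^bsup>Suc k\<^esup>. a \<notin> e} = [A]\<^bsup>Suc k\<^esup>"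
    using assms by (auto simp: nsets_def)
  moreover have "link a ([insert a A]\<^bsup>Suc k\<^esup>) = [A]\<^bsup>k\<^esup>"
  proof
    show "link a ([insert a A]\<^bsup>Suc k\<^esup>) \<subseteq> [A]\<^bsup>k\<^esup>"
      by (auto simp: link_def nsets_def)
    show "[A]\<^bsup>k\<^esup> \<subseteq> link a ([insert a A]\<^bsup>Suc k\<^esup>)"
    proof
      fix f assume f: "f \<in> [A]\<^bsup>k\<^esup>"
      then have "f = insert a f - {a}" "insert a f \<in> {e \<in> [insert a A]\<^bsup>Suc k\<^esup>. a \<in> e}"
        using assms by (auto simp: nsets_def card_insert_if)
      then show "f \<in> link a ([insert a A]\<^bsup>Suc k\<^esup>)" unfolding link_def by (rule image_eqI)
    qed
  qed
  ultimately show ?thesis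
    using lagrange_poly_split[of "[insert a A]\<^bsup>Suc k\<^esup>" x a] assms
    by (simp add: finite_imp_finite_nsets) (simp add: nsets_def)
qed

lemma lagrange_poly_nsets_1: "lagrange_poly ([A]\<^bsup>1\<^esup>) x = sum x A"
  by (simp add: lagrange_poly_def nsets_one sum.reindex)

lemma lagrange_poly_nsets_2:
  assumes "finite A"
  shows "2 * lagrange_poly ([A]\<^bsup>2\<^esup>) x = (sum x A)\<^sup>2 - (\<Sum>i\<in>A. (x i)\<^sup>2)"
  using assms
proof (induction A)
  case empty
  then show ?case by (simp add: lagrange_poly_def nsets_empty_iff)
next
  case (insert a A)
  then show ?case
    using lagrange_poly_nsets_insert[of A a 1 x] lagrange_poly_nsets_1[of A x]
    by (simp add: numeral_2_eq_2 power2_eq_square algebra_simps)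
qed

lemma lagrange_poly_mono:
  assumes "finite F" "E \<subseteq> F" "\<And>e i. e \<in> F \<Longrightarrow> i \<in> e \<Longrightarrow> 0 \<le> x i"
  shows "lagrange_poly E x \<le> lagrange_poly F x"
  unfolding lagrange_poly_def using assms by (intro sum_mono2) (auto intro!: prod_nonneg)

text \<open>Euler's identity for a homogeneous polynomial of degree 3, by double counting of pairs
  of a vertex and an edge through it.\<close>

lemma sum_link_eq_three_times:
  assumes "finite V" "E \<subseteq> [V]\<^bsup>3\<^esup>"
  shows "(\<Sum>j\<in>V. x j * lagrange_poly (link j E) x) = 3 * lagrange_poly E x"
proof -
  have fE: "finite E" using assms finite_imp_finite_nsets finite_subset by metis
  have "(\<Sum>j\<in>V. x j * lagrange_poly (link j E) x) = (\<Sum>j\<in>V. \<Sum>e | e \<in> E \<and> j \<in> e. \<Prod>i\<in>e. x i)"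
    using assms by (intro sum.cong weight_times_link) (auto simp: nsets_def)
  also have "\<dots> = (\<Sum>e\<in>E. \<Sum>j | j \<in> V \<and> j \<in> e. \<Prod>i\<in>e. x i)"
    using assms fE by (intro sum.swap_restrict) auto
  also have "\<dots> = (\<Sum>e\<in>E. 3 * (\<Prod>i\<in>e. x i))"
  proof (rule sum.cong[OF refl])
    fix e assume "e \<in> E"
    then have "{j. j \<in> V \<and> j \<in> e} = e" "card e = 3" using assms by (auto simp: nsets_def)
    then show "(\<Sum>j | j \<in> V \<and> j \<in> e. \<Prod>i\<in>e. x i) = 3 * (\<Prod>i\<in>e. x i)" by simp
  qed
  finally show ?thesis by (simp add: lagrange_poly_def sum_distrib_left)
qed

text \<open>
  Along \<open>(1 - s)x + s e\<^sub>j\<close> the polynomial is \<open>(1 - s)\<^sup>3 L + s (1 - s)\<^sup>2 D\<close>, where \<open>D\<close> is the weight of the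
  link of \<open>j\<close>; its slope at \<open>s = 0\<close> is \<open>D - 3 L\<close>.
\<close>

lemma link_at_maximum_le:
  assumes G: "three_graph V E" and x: "x \<in> weightings V"
    and max: "\<And>y. y \<in> weightings V \<Longrightarrow> lagrange_poly E y \<le> lagrange_poly E x"
    and j: "j \<in> V"
  shows "lagrange_poly (link j E) x \<le> 3 * lagrange_poly E x"
proof (rule ccontr)
  define L where "L = lagrange_poly E x"
  define D where "D = lagrange_poly (link j E) x"
  define d where "d = D - 3 * L"
  assume "\<not> ?thesis"
  then have d: "d > 0" by (simp add: d_def D_def L_def)
  have fin: "finite V" and E: "E \<subseteq> [V]\<^bsup>3\<^esup>" using G by (auto simp: three_graph_def)
  have fE: "finite E" using fin E finite_imp_finite_nsets finite_subset by metis
  have fe: "finite e" "card e = 3" if "e \<in> E" for e using E that by (auto simp: nsets_def)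
  have L0: "L \<ge> 0"
    unfolding L_def lagrange_poly_def using E x
    by (intro sum_nonneg prod_nonneg) (auto simp: nsets_def weightings_def)
  have expand: "(1 - s) ^ 3 * L + s * (1 - s)\<^sup>2 * D \<le> L" if s: "0 \<le> s" "s \<le> 1" for s
  proof -
    define y where "y = (\<lambda>i. (1 - s) * x i + (if i = j then s else 0))"
    have "sum y V = 1"
      using x j fin by (simp add: y_def weightings_def sum.distrib flip: sum_distrib_left)
    moreover have "0 \<le> y i" if "i \<in> V" for i using x s that by (auto simp: y_def weightings_def)
    ultimately have le: "lagrange_poly E y \<le> L" using max by (auto simp: L_def weightings_def)
    define P where "P = lagrange_poly {e \<in> E. j \<notin> e} x"
    have "lagrange_poly {e \<in> E. j \<notin> e} y = (1 - s) ^ 3 * P"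
      unfolding P_def using fe by (intro lagrange_poly_scale) (auto simp: y_def)
    moreover have "lagrange_poly (link j E) y = (1 - s) ^ 2 * D"
      unfolding D_def using fe by (intro lagrange_poly_scale) (auto simp: y_def link_def)
    moreover have "lagrange_poly E y = lagrange_poly {e \<in> E. j \<notin> e} y + y j * lagrange_poly (link j E) y"
      by (rule lagrange_poly_split) (use fE fe in auto)
    ultimately have "lagrange_poly E y = (1 - s) ^ 3 * P + ((1 - s) * x j + s) * ((1 - s)\<^sup>2 * D)"
      by (simp add: y_def)
    also have "\<dots> = (1 - s) ^ 3 * (P + x j * D) + s * (1 - s)\<^sup>2 * D"
      by (simp add: power2_eq_square power3_eq_cube algebra_simps)
    also have "P + x j * D = L"
      unfolding L_def D_def P_def by (rule lagrange_poly_split[symmetric]) (use fE fe in auto)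
    finally show ?thesis using le by simp
  qed
  \<comment> \<open>The expansion is L + s(d - s(3L + 2d)) plus a nonnegative cubic term. This
    \<open>s\<close> makes s(3L + 2d) equal to d/2, so the value exceeds \<open>L\<close>.\<close>
  define s where "s = d / (2 * (3 * L + 2 * d))"
  have s: "0 < s" "s \<le> 1" using d L0 by (auto simp: s_def field_simps)
  have "s * (3 * L + 2 * d) = d / 2" using d L0 by (simp add: s_def field_simps)
  then have "s * (d - s * (3 * L + 2 * d)) > 0" using d s by simp
  moreover have "(1 - s) ^ 3 * L + s * (1 - s)\<^sup>2 * D
      = L + s * (d - s * (3 * L + 2 * d)) + s ^ 3 * (2 * L + d)"
    by (simp add: d_def power2_eq_square power3_eq_cube algebra_simps)
  moreover have "s ^ 3 * (2 * L + d) \<ge> 0" using s L0 d by simp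
  ultimately show False using expand[of s] s by simp
qed

text \<open>The weighted average of all links is 3L by Euler's identity and none exceeds 3L, so a
  vertex of positive weight cannot fall short of it.\<close>

lemma link_at_maximum:
  assumes G: "three_graph V E" and x: "x \<in> weightings V"
    and max: "\<And>y. y \<in> weightings V \<Longrightarrow> lagrange_poly E y \<le> lagrange_poly E x"
    and j: "j \<in> V" "x j > 0"
  shows "lagrange_poly (link j E) x = 3 * lagrange_poly E x"
proof (rule ccontr)
  assume "\<not> ?thesis"
  then have less: "lagrange_poly (link j E) x < 3 * lagrange_poly E x"
    using link_at_maximum_le[OF G x max j(1)] by simp
  have fin: "finite V" and E: "E \<subseteq> [V]\<^bsup>3\<^esup>" using G by (auto simp: three_graph_def)
  have "(\<Sum>i\<in>V. x i * lagrange_poly (link i E) x) < (\<Sum>i\<in>V. x i * (3 * lagrange_poly E x))"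
    using less j x link_at_maximum_le[OF G x max]
    by (intro sum_strict_mono_ex1[OF fin]) (auto simp: weightings_def intro!: mult_left_mono bexI[of _ j])
  also have "\<dots> = 3 * lagrange_poly E x"
    using x by (simp add: weightings_def flip: sum_distrib_right)
  finally show False using sum_link_eq_three_times[OF fin E] by simp
qed

text \<open>The situation on the support of a maximiser: positive weights, the induced edges, and
  the Lagrange multiplier condition with multiplier three times the value.\<close>

locale stationary_weighting =
  fixes S :: "'a set" and E :: "'a set set" and x :: "'a \<Rightarrow> real"
  assumes fin: "finite S" and edges: "E \<subseteq> [S]\<^bsup>3\<^esup>"
    and pos: "\<And>i. i \<in> S \<Longrightarrow> 0 < x i" and sum1: "sum x S = 1"
    and stationary: "\<And>j. j \<in> S \<Longrightarrow> lagrange_poly (link j E) x = 3 * lagrange_poly E x"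

lemma lagrangian_stationary:
  assumes G: "three_graph V E" and "V \<noteq> {}"
  obtains S x where "S \<subseteq> V" "stationary_weighting S {e \<in> E. e \<subseteq> S} x"
    "lagrange_poly {e \<in> E. e \<subseteq> S} x = lagrangian V E"
proof -
  obtain x where x: "x \<in> weightings V" and L: "lagrange_poly E x = lagrangian V E"
    and max: "\<And>y. y \<in> weightings V \<Longrightarrow> lagrange_poly E y \<le> lagrange_poly E x"
    using lagrangian_attained[OF assms] by blast
  define S where "S = {i \<in> V. x i > 0}"
  have fin: "finite V" and E: "E \<subseteq> [V]\<^bsup>3\<^esup>" using G by (auto simp: three_graph_def)
  have fE: "finite E" using fin E finite_imp_finite_nsets finite_subset by metis
  have zero: "x i = 0" if "i \<in> V - S" for i using that x by (force simp: S_def weightings_def)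
  \<comment> \<open>An edge with a vertex of weight 0 contributes nothing. Stated for a general
    \<open>F\<close> because it is applied both to \<open>E\<close> and to links.\<close>
  have restr: "lagrange_poly {e \<in> F. e \<subseteq> S} x = lagrange_poly F x"
    if "finite F" "\<And>e. e \<in> F \<Longrightarrow> finite e \<and> e \<subseteq> V" for F
    unfolding lagrange_poly_def
  proof (rule sum.mono_neutral_left[OF that(1)])
    show "\<forall>e\<in>F - {e \<in> F. e \<subseteq> S}. prod x e = 0"
    proof
      fix e assume e: "e \<in> F - {e \<in> F. e \<subseteq> S}"
      then obtain i where "i \<in> e" "i \<notin> S" by auto
      then show "prod x e = 0" using e that zero by (intro prod_zero) auto
    qed
  qed auto
  have eV: "finite e \<and> e \<subseteq> V" if "e \<in> E" for e using that E by (auto simp: nsets_def)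
  have LS: "lagrange_poly {e \<in> E. e \<subseteq> S} x = lagrange_poly E x" using eV fE by (intro restr) auto
  have "stationary_weighting S {e \<in> E. e \<subseteq> S} x"
  proof
    show "finite S" using fin by (simp add: S_def)
    show "{e \<in> E. e \<subseteq> S} \<subseteq> [S]\<^bsup>3\<^esup>" using E by (auto simp: nsets_def)
    show "0 < x i" if "i \<in> S" for i using that by (simp add: S_def)
    have "sum x S = sum x V" using zero fin by (intro sum.mono_neutral_left) (auto simp: S_def)
    then show "sum x S = 1" using x by (simp add: weightings_def)
    fix j assume j: "j \<in> S"
    have "link j {e \<in> E. e \<subseteq> S} = {f \<in> link j E. f \<subseteq> S}"
      using j by (auto simp: link_def)
    moreover have "lagrange_poly {f \<in> link j E. f \<subseteq> S} x = lagrange_poly (link j E) x"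
      using eV fE by (intro restr) (auto simp: link_def)
    ultimately show "lagrange_poly (link j {e \<in> E. e \<subseteq> S}) x = 3 * lagrange_poly {e \<in> E. e \<subseteq> S} x"
      using link_at_maximum[OF G x max, of j] j unfolding LS by (simp add: S_def)
  qed
  then show thesis using that[of S x] L LS by (auto simp: S_def)
qed

section \<open>Upper bounds for the value of a stationary weighting\<close>

context stationary_weighting
begin

lemma fin_edges: "finite E"
  using fin edges finite_imp_finite_nsets finite_subset by metis

lemma nonempty: "S \<noteq> {}"
  using sum1 by auto

lemma lagrange_poly_le_deviation:
  assumes j: "j \<in> S"
  shows "6 * lagrange_poly E x \<le> (1 - x j)\<^sup>2 - (\<Sum>i\<in>S - {j}. (x i)\<^sup>2)"
proof -
  have "link j E \<subseteq> [S - {j}]\<^bsup>2\<^esup>" using edges by (fastforce simp: link_def nsets_def)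
  then have "lagrange_poly (link j E) x \<le> lagrange_poly ([S - {j}]\<^bsup>2\<^esup>) x"
    using pos fin by (intro lagrange_poly_mono finite_imp_finite_nsets)
      (auto simp: nsets_def intro!: less_imp_le)
  moreover have "sum x (S - {j}) = 1 - x j" using sum1 fin j by (simp add: sum_diff1)
  ultimately show ?thesis using stationary[OF j] lagrange_poly_nsets_2[of "S - {j}" x] fin by simp
qed

text \<open>Cauchy-Schwarz on the vertices other than \<open>j\<close> removes the sum of squares
  from the previous bound.\<close>

lemma lagrange_poly_le_quadratic:
  assumes j: "j \<in> S"
  shows "6 * lagrange_poly E x * (real (card S) - 1) \<le> (1 - x j)\<^sup>2 * (real (card S) - 2)"
proof -
  have c: "real (card (S - {j})) = real (card S) - 1"
    using j fin nonempty by (simp add: of_nat_diff Suc_le_eq card_gt_0_iff)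
  have "sum x (S - {j}) = 1 - x j" using sum1 fin j by (simp add: sum_diff1)
  then have "(1 - x j)\<^sup>2 \<le> (\<Sum>i\<in>S - {j}. (x i)\<^sup>2) * (real (card S) - 1)"
    using sum_squared_le_sum_of_squares[of x "S - {j}"] c by simp
  moreover have "6 * lagrange_poly E x * (real (card S) - 1)
      \<le> ((1 - x j)\<^sup>2 - (\<Sum>i\<in>S - {j}. (x i)\<^sup>2)) * (real (card S) - 1)"
    using lagrange_poly_le_deviation[OF j] c by (intro mult_right_mono) auto
  ultimately show ?thesis by (simp add: algebra_simps)
qed

lemma lagrange_poly_le_complete:
  "lagrange_poly E x \<le> (real (card S) - 1) * (real (card S) - 2) / (6 * (real (card S))\<^sup>2)"
proof -
  define k where "k = real (card S)"
  have k1: "k \<ge> 1" using nonempty fin by (simp add: k_def Suc_le_eq card_gt_0_iff)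
  obtain v where v: "v \<in> S" "x v = Max (x ` S)"
    using Max_in[of "x ` S"] fin nonempty by (metis (no_types) empty_is_image finite_imageI imageE)
  then have vmax: "x i \<le> x v" if "i \<in> S" for i using that fin by simp
  have "1 \<le> k * x v" using sum_bounded_above[of S x "x v"] vmax sum1 by (simp add: k_def)
  then have "1 - x v \<le> (k - 1) / k" using k1 by (simp add: field_simps)
  moreover have "x v \<le> 1"
    using member_le_sum[of v S x] v fin sum1 pos by (simp add: less_imp_le)
  ultimately have sq: "(1 - x v)\<^sup>2 \<le> ((k - 1) / k)\<^sup>2" by (intro power_mono) auto
  show ?thesis
  \<comment> \<open>Cancelling k - 1 takes at least two vertices; a support of one vertex carries no
    edge.\<close>
  proof (cases "card S \<ge> 2")
    case True
    then have k2: "k \<ge> 2" by (simp add: k_def)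
    have "6 * lagrange_poly E x * (k - 1) \<le> ((k - 1) / k)\<^sup>2 * (k - 2)"
      using lagrange_poly_le_quadratic[OF v(1)] mult_right_mono[OF sq, of "k - 2"] k2
      by (simp add: k_def)
    also have "\<dots> = ((k - 1) * (k - 2) / k\<^sup>2) * (k - 1)" using k2 by (simp add: power2_eq_square)
    finally have "6 * lagrange_poly E x \<le> (k - 1) * (k - 2) / k\<^sup>2"
      by (rule mult_right_le_imp_le) (use k2 in simp)
    then show ?thesis by (simp add: k_def)
  next
    case False
    then have "card S < 3" by simp
    then have "E = {}" using edges fin nsets_eq_empty[of S 3] by auto
    moreover have "k = 1" using False k1 by (auto simp: k_def)
    ultimately show ?thesis by (simp add: lagrange_poly_def k_def)
  qed
qed

text \<open>Summing the stationarity condition over \<open>S\<close> writes 3 \<open>card S\<close>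
  times the value as a sum of pair products over the edges. Subtracting 2/a times the value edge by
  edge leaves at most the square of \<open>a\<close> for each.\<close>

lemma lagrange_poly_le_card:
  assumes a: "\<And>i. i \<in> S \<Longrightarrow> x i \<le> a"
  shows "lagrange_poly E x * (3 * real (card S) - 2 / a) \<le> real (card E) * a\<^sup>2"
proof -
  have "3 * real (card S) * lagrange_poly E x = (\<Sum>j\<in>S. lagrange_poly (link j E) x)"
    using stationary by simp
  also have "\<dots> = (\<Sum>j\<in>S. \<Sum>e | e \<in> E \<and> j \<in> e. \<Prod>i\<in>e - {j}. x i)"
    by (simp add: lagrange_poly_link)
  also have "\<dots> = (\<Sum>e\<in>E. \<Sum>j | j \<in> S \<and> j \<in> e. \<Prod>i\<in>e - {j}. x i)"
    using fin fin_edges by (intro sum.swap_restrict) auto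
  finally have "lagrange_poly E x * (3 * real (card S) - 2 / a)
      = (\<Sum>e\<in>E. (\<Sum>j | j \<in> S \<and> j \<in> e. \<Prod>i\<in>e - {j}. x i) - 2 / a * (\<Prod>i\<in>e. x i))"
    by (simp add: lagrange_poly_def sum_subtractf sum_distrib_left sum_divide_distrib algebra_simps)
  also have "\<dots> \<le> (\<Sum>e\<in>E. a\<^sup>2)"
  proof (rule sum_mono)
    fix e assume e: "e \<in> E"
    then have eS: "e \<subseteq> S" "card e = 3" using edges by (auto simp: nsets_def)
    then obtain p q r where pqr: "e = {p, q, r}" "p \<noteq> q" "p \<noteq> r" "q \<noteq> r"
      by (auto simp: card_3_iff)
    then have "{j. j \<in> S \<and> j \<in> e} = {p, q, r}" using eS by auto
    moreover have "{p, q, r} - {p} = {q, r}" "{p, q, r} - {q} = {p, r}" "{p, q, r} - {r} = {p, q}"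
      using pqr by auto
    ultimately have "(\<Sum>j | j \<in> S \<and> j \<in> e. \<Prod>i\<in>e - {j}. x i) - 2 / a * (\<Prod>i\<in>e. x i)
        = x p * x q + x p * x r + x q * x r - 2 / a * (x p * x q * x r)"
      using pqr by simp
    also have "\<dots> \<le> a\<^sup>2" using pqr eS pos a by (intro pairwise_products_minus_triple_product_le) auto
    finally show "(\<Sum>j | j \<in> S \<and> j \<in> e. \<Prod>i\<in>e - {j}. x i) - 2 / a * (\<Prod>i\<in>e. x i) \<le> a\<^sup>2" .
  qed
  finally show ?thesis by simp
qed

end

text \<open>Extends the bound to arbitrary weightings. A maximiser may be supported on fewer than
  \<open>n\<close> vertices, which is where monotonicity in the size enters.\<close>

lemma lagrange_poly_complete_le:
  assumes "finite A" "card A = n" "n \<ge> 4" "y \<in> weightings A" "E \<subseteq> [A]\<^bsup>3\<^esup>"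
  shows "lagrange_poly E y \<le> (real n - 1) * (real n - 2) / (6 * (real n)\<^sup>2)"
proof -
  have G: "three_graph A E" using assms by (simp add: three_graph_def)
  have ne: "A \<noteq> {}" using assms by auto
  obtain S x where S: "S \<subseteq> A" and st: "stationary_weighting S {e \<in> E. e \<subseteq> S} x"
    and L: "lagrange_poly {e \<in> E. e \<subseteq> S} x = lagrangian A E"
    using lagrangian_stationary[OF G ne] by metis
  interpret stationary_weighting S "{e \<in> E. e \<subseteq> S}" x by (rule st)
  have "card S \<le> n" "1 \<le> card S"
    using S assms(1,2) card_mono nonempty fin by (auto simp: Suc_le_eq card_gt_0_iff)
  have "lagrange_poly E y \<le> lagrangian A E" using lagrangian_attained[OF G ne] assms(4) by metis
  also have "\<dots> \<le> (real (card S) - 1) * (real (card S) - 2) / (6 * (real (card S))\<^sup>2)"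
    using lagrange_poly_le_complete L by simp
  also have "\<dots> \<le> (real n - 1) * (real n - 2) / (6 * (real n)\<^sup>2)"
  proof (cases "card S = n")
    case False
    then show ?thesis using complete_lagrangian_value_strict_mono[of "card S" n] \<open>card S \<le> n\<close> \<open>1 \<le> card S\<close> assms(3)
      by simp
  qed simp
  finally show ?thesis .
qed

section \<open>Size of the support\<close>

lemma ex_min_weight:
  fixes x :: "'a \<Rightarrow> real"
  assumes "finite A" "A \<noteq> {}"
  obtains u where "u \<in> A" "\<And>i. i \<in> A \<Longrightarrow> x u \<le> x i"
proof -
  have "Min (x ` A) \<in> x ` A" using assms by simp
  then obtain u where "u \<in> A" "x u = Min (x ` A)" by auto
  then show thesis using that[of u] assms by simp
qed

context stationary_weighting
begin

lemma obtain_max_weight: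
  obtains v where "v \<in> S" "\<And>i. i \<in> S \<Longrightarrow> x i \<le> x v" "1 \<le> real (card S) * x v" "0 < x v" "x v \<le> 1"
proof -
  obtain v where v: "v \<in> S" "\<And>i. i \<in> S \<Longrightarrow> - x v \<le> - x i"
    using ex_min_weight[OF fin nonempty, of "\<lambda>i. - x i"] by blast
  moreover have "1 \<le> real (card S) * x v" using sum_bounded_above[of S x "x v"] v sum1 by simp
  moreover have "x v \<le> 1"
    using member_le_sum[of v S x] v fin sum1 pos by (simp add: less_imp_le)
  ultimately show thesis using that[of v] pos by simp
qed

text \<open>With c = na, the edge-counting bound and the Cauchy-Schwarz bound become
  \<open>i\<close> and \<open>ii\<close> of \<open>large_support_inequalities_contradictory\<close>.
  The bound on \<open>card E\<close> is (n choose 3) + (n-1 choose 2).\<close>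

lemma lagrange_poly_less_if_card_ge:
  assumes n: "n \<ge> 4" "card S \<ge> n + 2"
    and E: "real (card E) \<le> (real n - 1) * (real n - 2) * (real n + 3) / 6"
  shows "lagrange_poly E x < (real n - 1) * (real n - 2) / (6 * (real n)\<^sup>2)"
proof (rule ccontr)
  assume "\<not> ?thesis"
  then have L: "(real n - 1) * (real n - 2) / (6 * (real n)\<^sup>2) \<le> lagrange_poly E x" by simp
  define k where "k = real (card S)"
  define N where "N = real n"
  define q where "q = (N - 1) * (N - 2) / 6"
  have N4: "N \<ge> 4" using n by (simp add: N_def)
  have q: "q > 0" using N4 by (simp add: q_def)
  have L: "q / N\<^sup>2 \<le> lagrange_poly E x" using L by (simp add: q_def N_def)
  obtain v where v: "v \<in> S" "\<And>i. i \<in> S \<Longrightarrow> x i \<le> x v" "1 \<le> k * x v" "0 < x v" "x v \<le> 1"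
    using obtain_max_weight unfolding k_def by blast
  define a where "a = x v"
  have a: "1 \<le> k * a" "0 < a" "a \<le> 1" using v by (auto simp: a_def)
  have kn: "k \<ge> N + 2" using n by (simp add: k_def N_def)
  have i: "3 * k * (N * a) \<le> (N + 3) * (N * a) ^ 3 + 2 * N"
  proof -
    \<comment> \<open>The factor 3k - 2/a must be nonnegative before the value may be replaced by
      its lower bound.\<close>
    have "2 / a \<le> 2 * k" using a by (simp add: field_simps)
    then have "0 \<le> 3 * k - 2 / a" using kn N4 by simp
    then have "q / N\<^sup>2 * (3 * k - 2 / a) \<le> lagrange_poly E x * (3 * k - 2 / a)"
      using L by (intro mult_right_mono) auto
    also have "\<dots> \<le> real (card E) * a\<^sup>2"
      using lagrange_poly_le_card[of a] v(2) by (simp add: a_def k_def)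
    also have "\<dots> \<le> q * (N + 3) * a\<^sup>2"
      using E by (intro mult_right_mono) (auto simp: q_def N_def)
    finally have "q * ((3 * k - 2 / a) / N\<^sup>2) \<le> q * ((N + 3) * a\<^sup>2)" by (simp add: mult.assoc)
    then have "(3 * k - 2 / a) / N\<^sup>2 \<le> (N + 3) * a\<^sup>2"
      using q by (rule mult_left_le_imp_le)
    then have "(3 * k - 2 / a) / N\<^sup>2 * (N ^ 3 * a) \<le> (N + 3) * a\<^sup>2 * (N ^ 3 * a)"
      using N4 a by (intro mult_right_mono) auto
    moreover have "(3 * k - 2 / a) / N\<^sup>2 * (N ^ 3 * a) = 3 * k * (N * a) - 2 * N"
      using N4 a by (simp add: field_simps power2_eq_square power3_eq_cube)
    ultimately show ?thesis by (simp add: power2_eq_square power3_eq_cube algebra_simps)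
  qed
  have ii: "(N - 1) * (N - 2) * (k - 1) \<le> (N - N * a)\<^sup>2 * (k - 2)"
  proof -
    have "6 * (q / N\<^sup>2) * (k - 1) \<le> 6 * lagrange_poly E x * (k - 1)"
      using L kn N4 by (intro mult_right_mono mult_left_mono) auto
    also have "\<dots> \<le> (1 - a)\<^sup>2 * (k - 2)"
      using lagrange_poly_le_quadratic[OF v(1)] by (simp add: k_def a_def)
    finally have "N\<^sup>2 * (6 * (q / N\<^sup>2) * (k - 1)) \<le> N\<^sup>2 * ((1 - a)\<^sup>2 * (k - 2))"
      by (intro mult_left_mono) auto
    moreover have "N\<^sup>2 * (6 * (q / N\<^sup>2) * (k - 1)) = (N - 1) * (N - 2) * (k - 1)"
      using N4 by (simp add: q_def)
    moreover have "N - N * a = N * (1 - a)" by (simp add: algebra_simps)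
    ultimately show ?thesis by (simp add: power_mult_distrib mult.assoc)
  qed
  have "n = 4 \<or> n \<ge> 5" using n by auto
  then have "N = 4 \<or> N \<ge> 5" by (auto simp: N_def)
  moreover have "N * 1 \<le> N * (k * a)" using a N4 by (intro mult_left_mono) auto
  ultimately show False
    using large_support_inequalities_contradictory[of N k "N * a"] kn N4 a i ii
    by (simp add: mult.left_commute mult_left_le)
qed

text \<open>Meant for \<open>T\<close> the four lightest vertices. Otherwise each of them deviates
  from the largest weight \<open>a\<close> by at least ha. The deviations over \<open>S\<close> sum
  to (n+1)a - 1, and \<open>lagrange_poly_le_deviation\<close> controls their squares.\<close>

lemma fourth_smallest_weight_gt:
  assumes n: "n \<ge> 4" "card S = n + 1" and T: "T \<subseteq> S" "card T = 4"
    and small: "\<And>i. i \<in> T \<Longrightarrow> x i \<le> b" and v: "v \<in> S" "\<And>i. i \<in> S \<Longrightarrow> x i \<le> x v"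
    and L: "(real n - 1) * (real n - 2) / (6 * (real n)\<^sup>2) \<le> lagrange_poly E x"
  shows "(1 - real n / (3 * real n - 2)) * x v < b"
proof (rule ccontr)
  define a where "a = x v"
  define N where "N = real n"
  define h where "h = N / (3 * N - 2)"
  have N4: "N \<ge> 4" using n by (simp add: N_def)
  have h: "h > 0" using N4 by (simp add: h_def)
  assume "\<not> ?thesis"
  then have dev: "h * a \<le> a - x i" if "i \<in> T" for i
    using small[OF that] by (simp add: h_def a_def N_def algebra_simps)
  have a: "0 < a" "a \<le> 1"
    using v pos member_le_sum[of v S x] fin sum1 by (auto simp: a_def less_imp_le)
  have le: "x i \<le> a" if "i \<in> S" for i using v that by (simp add: a_def)
  have sums: "(\<Sum>i\<in>S. a - x i) = (N + 1) * a - 1"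
    using n sum1 by (simp add: sum_subtractf N_def)
  have "(\<Sum>i\<in>T. h * a) \<le> (\<Sum>i\<in>T. a - x i)" by (intro sum_mono dev)
  also have "\<dots> \<le> (\<Sum>i\<in>S. a - x i)" using le T fin by (intro sum_mono2) auto
  finally have lo: "4 * h * a \<le> (N + 1) * a - 1" using T sums by simp
  have "(\<Sum>i\<in>T. (h * a)\<^sup>2) \<le> (\<Sum>i\<in>T. (a - x i)\<^sup>2)"
    using a h by (intro sum_mono power_mono dev) auto
  also have "\<dots> \<le> (\<Sum>i\<in>S. (a - x i)\<^sup>2)" using T fin by (intro sum_mono2) auto
  also have "\<dots> = (\<Sum>i\<in>S. a\<^sup>2 - 2 * a * x i + (x i)\<^sup>2)"
    by (simp add: power2_eq_square algebra_simps)
  also have "\<dots> = (N + 1) * a\<^sup>2 - 2 * a + (\<Sum>i\<in>S. (x i)\<^sup>2)"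
    using n sum1 by (simp add: sum.distrib sum_subtractf N_def flip: sum_distrib_left)
  also have "(\<Sum>i\<in>S. (x i)\<^sup>2) = a\<^sup>2 + (\<Sum>i\<in>S - {v}. (x i)\<^sup>2)"
    using fin v by (simp add: a_def sum.remove)
  finally have sq: "4 * h\<^sup>2 * a\<^sup>2 \<le> (N + 2) * a\<^sup>2 - 2 * a + (\<Sum>i\<in>S - {v}. (x i)\<^sup>2)"
    using T by (simp add: power_mult_distrib algebra_simps)
  have L6: "(N - 1) * (N - 2) / N\<^sup>2 \<le> 6 * lagrange_poly E x" using L by (simp add: N_def)
  have d: "4 * h\<^sup>2 * a\<^sup>2 \<le> 1 - 4 * a + (N + 3) * a\<^sup>2 - (N - 1) * (N - 2) / N\<^sup>2"
    using sq L6 lagrange_poly_le_deviation[OF v(1)]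
    by (simp add: a_def power2_eq_square algebra_simps)
  have "(N - 1) * (N - 2) / N\<^sup>2 * N \<le> 6 * lagrange_poly E x * N"
    using L6 N4 by (intro mult_right_mono) auto
  also have "\<dots> \<le> (1 - a)\<^sup>2 * (N - 1)"
    using lagrange_poly_le_quadratic[OF v(1)] n by (simp add: N_def a_def)
  also have "(N - 1) * (N - 2) / N\<^sup>2 * N = (N - 2) / N * (N - 1)"
    using N4 by (simp add: power2_eq_square)
  finally have "(N - 2) / N * (N - 1) \<le> (1 - a)\<^sup>2 * (N - 1)" .
  then have qm: "(N - 2) / N \<le> (1 - a)\<^sup>2"
    by (rule mult_right_le_imp_le) (use N4 in simp)
  have "n = 4 \<or> n \<ge> 5" using n by auto
  then have "N = 4 \<or> N \<ge> 5" by (auto simp: N_def)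
  then show False
    using small_weights_inequalities_contradictory[of N a] lo qm a d by (simp add: h_def)
qed

section \<open>Supports of n + 1 vertices: merging the two lightest\<close>

lemma lagrange_poly_less_if_card_Suc:
  assumes n: "n \<ge> 4" "card S = n + 1"
    and E: "real (card E) \<le> (real n - 1) * (real n - 2) * (real n + 3) / 6 - real n / 2"
  shows "lagrange_poly E x < (real n - 1) * (real n - 2) / (6 * (real n)\<^sup>2)"
proof (rule ccontr)
  define L0 where "L0 = (real n - 1) * (real n - 2) / (6 * (real n)\<^sup>2)"
  assume "\<not> ?thesis"
  then have L: "L0 \<le> lagrange_poly E x" by (simp add: L0_def)
  obtain u where u: "u \<in> S" "\<And>i. i \<in> S \<Longrightarrow> x u \<le> x i"
    using ex_min_weight[OF fin nonempty] by blast
  have "card (S - {u}) = n" using u n fin by simp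
  then have "S - {u} \<noteq> {}" using n by (intro notI) simp
  then obtain v where v: "v \<in> S - {u}" "\<And>i. i \<in> S - {u} \<Longrightarrow> x v \<le> x i"
    using ex_min_weight[of "S - {u}" x] fin by blast
  define A where "A = S - {u, v}"
  have "card {u, v} = 2" using v by auto
  then have cA: "card A = n - 1" using u v n fin by (simp add: A_def card_Diff_subset)
  have finA: "finite A" using fin by (simp add: A_def)
  have "A \<noteq> {}" using cA n by (intro notI) simp
  then obtain w where w: "w \<in> A" "\<And>i. i \<in> A \<Longrightarrow> x w \<le> x i"
    using ex_min_weight[of A x] finA by blast
  have cAw: "card (A - {w}) = n - 2" using cA w finA by simp
  have "A - {w} \<noteq> {}" using cAw n by (intro notI) simp
  then obtain s where s: "s \<in> A - {w}" "\<And>i. i \<in> A - {w} \<Longrightarrow> x s \<le> x i"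
    using ex_min_weight[of "A - {w}" x] finA by blast
  have S_eq: "S = insert u (insert v A)" using u v by (auto simp: A_def)
  have uv: "u \<noteq> v" "u \<notin> A" "v \<notin> A" using v by (auto simp: A_def)
  have xpos: "0 < x u" "0 < x v" "0 < x w" "0 < x s" using u v w s pos by (auto simp: A_def)
  have ord: "x u \<le> x v" "x v \<le> x w" "x w \<le> x s" using u v w s by (auto simp: A_def)
  obtain m where m: "m \<in> S" "\<And>i. i \<in> S \<Longrightarrow> x i \<le> x m" "0 < x m"
    using obtain_max_weight by blast
  define a where "a = x m"

  have s_large: "(1 - real n / (3 * real n - 2)) * a < x s"
    unfolding a_def
  proof (rule fourth_smallest_weight_gt[OF n, of "{u, v, w, s}"])
    show "{u, v, w, s} \<subseteq> S" "card {u, v, w, s} = 4" using u v w s by (auto simp: A_def)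
    show "x i \<le> x s" if "i \<in> {u, v, w, s}" for i using that ord by auto
  qed (use m L in \<open>auto simp: L0_def\<close>)

  \<comment> \<open>The missing triples \<open>M\<close> split into \<open>M1\<close>, those through
    both \<open>u\<close> and \<open>v\<close>, and \<open>M2\<close>, the others.\<close>
  define M where "M = [S]\<^bsup>3\<^esup> - E"
  define B where "B = {i \<in> A. {i, u, v} \<in> E}"
  define M1 where "M1 = (\<lambda>i. {i, u, v}) ` (A - B)"
  define M2 where "M2 = {e \<in> M. \<not> {u, v} \<subseteq> e}"
  have finM: "finite M" using fin by (simp add: M_def finite_imp_finite_nsets)
  have inj: "inj_on (\<lambda>i. {i, u, v}) (A - B)"
    using uv by (intro inj_onI) (auto simp: doubleton_eq_iff insert_eq_iff)
  have M_eq: "M = M1 \<union> M2"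
  proof -
    have "e \<in> M1" if e: "e \<in> M" "{u, v} \<subseteq> e" for e
    proof -
      have "card (e - {u, v}) = 1"
        using e uv by (auto simp: M_def nsets_def card_Diff_subset)
      then obtain i where "e - {u, v} = {i}" by (auto simp: card_1_singleton_iff)
      then have "e = {i, u, v}" "i \<in> A" using e by (auto simp: M_def nsets_def A_def)
      then show ?thesis using e by (auto simp: M1_def M_def B_def)
    qed
    moreover have "M1 \<subseteq> M"
      using u v uv by (auto simp: M1_def M_def B_def nsets_def A_def)
    ultimately show ?thesis by (auto simp: M2_def)
  qed
  have disj: "M1 \<inter> M2 = {}" by (auto simp: M1_def M2_def)
  have fin12: "finite M1" "finite M2" using finM M_eq by auto
  have "B \<subseteq> A" by (auto simp: B_def)
  define b where "b = real (card B)"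
  have bn: "b \<le> real n - 1"
    using card_mono[OF finA \<open>B \<subseteq> A\<close>] cA n by (simp add: b_def)
  have card1: "real (card M1) = real n - 1 - b"
    using card_image[OF inj] \<open>B \<subseteq> A\<close> finA cA n card_mono[OF finA \<open>B \<subseteq> A\<close>]
    by (simp add: M1_def card_Diff_subset finite_subset b_def of_nat_diff)
  have "card M = (n + 1 choose 3) - card E" "card E \<le> (n + 1 choose 3)"
    using edges fin n card_mono[OF finite_imp_finite_nsets[OF fin] edges]
    by (auto simp: M_def card_Diff_subset fin_edges)
  moreover have "real (n + 1 choose 3) = (real n + 1) * real n * (real n - 1) / 6"
    by (simp add: binomial_gbinomial gbinomial_prod_rev numeral_3_eq_3 field_simps)
  \<comment> \<open>Of these, n - 1 - b lie in \<open>M1\<close>, which leaves at least b + n/2 for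
    \<open>M2\<close>.\<close>
  ultimately have "real (card M) \<ge> real n - 1 + real n / 2"
    using E by (simp add: of_nat_diff field_simps)
  moreover have "card M = card M1 + card M2"
    unfolding M_eq using fin12 disj by (rule card_Un_disjoint)
  ultimately have card2: "real (card M2) \<ge> b + real n / 2" using card1 by simp

  have pair: "x w * x s \<le> x p * x q" if "p \<in> A" "q \<in> A" "p \<noteq> q" for p q
  proof (cases "p = w")
    case True
    then show ?thesis using that s xpos by (intro mult_mono) auto
  next
    case False
    then have "x s * x w \<le> x p * x q" using that s w xpos pos by (intro mult_mono) (auto simp: A_def less_imp_le)
    then show ?thesis by (simp add: mult.commute)
  qed
  \<comment> \<open>A triple in \<open>M2\<close> omits \<open>u\<close> or \<open>v\<close>, hence
    has two vertices in \<open>A\<close>; the third weighs at least \<open>x u\<close>.\<close>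
  have prod2: "x u * (x w * x s) \<le> prod x e" if e: "e \<in> M2" for e
  proof -
    have e': "e \<subseteq> S" "card e = 3" "finite e" using e by (auto simp: M2_def M_def nsets_def)
    then have "e \<noteq> {}" by auto
    then obtain c where c: "c \<in> e" "e - {c} \<subseteq> A"
    proof (cases "e \<inter> {u, v} = {}")
      case True
      then show thesis using \<open>e \<noteq> {}\<close> e' that by (auto simp: A_def)
    next
      case False
      then show thesis using e e' that by (auto simp: A_def M2_def)
    qed
    have "card (e - {c}) = 2" using c e' by simp
    then obtain p q where pq: "e - {c} = {p, q}" "p \<noteq> q" by (auto simp: card_2_iff)
    have "prod x e = x c * (x p * x q)"
      using prod.remove[OF e'(3) c(1), of x] pq by simp
    moreover have "x u * (x w * x s) \<le> x c * (x p * x q)"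
    proof (rule mult_mono)
      show "x u \<le> x c" "0 \<le> x c" using u c e' pos by (auto simp: less_imp_le)
      show "x w * x s \<le> x p * x q" using pq c by (intro pair) auto
    qed (use xpos in simp)
    ultimately show ?thesis by simp
  qed
  have poly2: "(b + real n / 2) * (x u * (x w * x s)) \<le> lagrange_poly M2 x"
  proof -
    have "(b + real n / 2) * (x u * (x w * x s)) \<le> real (card M2) * (x u * (x w * x s))"
      using card2 xpos by (intro mult_right_mono) auto
    also have "\<dots> \<le> lagrange_poly M2 x"
      unfolding lagrange_poly_def by (intro sum_bounded_below prod2)
    finally show ?thesis .
  qed
  have poly1: "lagrange_poly M1 x = x u * x v * (sum x A - sum x B)"
  proof -
    have "lagrange_poly M1 x = (\<Sum>i\<in>A - B. prod x {i, u, v})"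
      unfolding lagrange_poly_def M1_def by (simp add: sum.reindex[OF inj])
    also have "\<dots> = (\<Sum>i\<in>A - B. x i * (x u * x v))"
    proof (rule sum.cong[OF refl])
      fix i assume "i \<in> A - B"
      then have "i \<noteq> u" "i \<noteq> v" using uv by auto
      then show "prod x {i, u, v} = x i * (x u * x v)" using uv by simp
    qed
    also have "\<dots> = x u * x v * (\<Sum>i\<in>A - B. x i)" by (simp add: sum_distrib_left mult_ac)
    finally show ?thesis using finA \<open>B \<subseteq> A\<close> by (simp add: sum_diff)
  qed

  have merged: "lagrange_poly ([S]\<^bsup>3\<^esup>) x \<le> L0 + x u * x v * sum x A"
  proof -
    \<comment> \<open>Moving the weight of \<open>u\<close> to \<open>v\<close> preserves every
      triple with at most one of them; only those through both are lost.\<close>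
    define y where "y = x(v := x u + x v)"
    have agree: "lagrange_poly ([A]\<^bsup>k\<^esup>) y = lagrange_poly ([A]\<^bsup>k\<^esup>) x" for k
      unfolding lagrange_poly_def using uv
      by (intro sum.cong prod.cong) (auto simp: y_def nsets_def)
    have ins: "lagrange_poly ([insert v A]\<^bsup>3\<^esup>) z = lagrange_poly ([A]\<^bsup>3\<^esup>) z + z v * lagrange_poly ([A]\<^bsup>2\<^esup>) z"
      "lagrange_poly ([insert v A]\<^bsup>2\<^esup>) z = lagrange_poly ([A]\<^bsup>2\<^esup>) z + z v * sum z A" for z
      using lagrange_poly_nsets_insert[OF finA uv(3), of 2 z]
        lagrange_poly_nsets_insert[OF finA uv(3), of 1 z] lagrange_poly_nsets_1[of A z]
      by (simp_all add: numeral_2_eq_2 numeral_3_eq_3)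
    have "lagrange_poly ([S]\<^bsup>3\<^esup>) x
        = lagrange_poly ([insert v A]\<^bsup>3\<^esup>) x + x u * lagrange_poly ([insert v A]\<^bsup>2\<^esup>) x"
      unfolding S_eq using lagrange_poly_nsets_insert[of "insert v A" u 2 x] finA uv
      by (simp add: numeral_2_eq_2 numeral_3_eq_3)
    also have "\<dots> = lagrange_poly ([insert v A]\<^bsup>3\<^esup>) y + x u * x v * sum x A"
      unfolding ins agree by (simp add: y_def algebra_simps)
    also have "lagrange_poly ([insert v A]\<^bsup>3\<^esup>) y \<le> L0"
      unfolding L0_def
    proof (rule lagrange_poly_complete_le[OF _ _ n(1) _ order_refl])
      have "sum y A = sum x A" using uv by (intro sum.cong) (auto simp: y_def)
      then have "sum y (insert v A) = 1"
        using sum1 uv finA by (simp add: y_def S_eq)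
      then show "y \<in> weightings (insert v A)"
        using xpos pos by (auto simp: weightings_def y_def A_def less_imp_le)
    qed (use finA uv cA n in auto)
    finally show ?thesis by simp
  qed
  have "lagrange_poly ([S]\<^bsup>3\<^esup>) x = lagrange_poly E x + lagrange_poly M x"
    unfolding lagrange_poly_def M_def
    using sum.subset_diff[OF edges finite_imp_finite_nsets[OF fin], of "prod x"] by simp
  also have "lagrange_poly M x = lagrange_poly M1 x + lagrange_poly M2 x"
    unfolding lagrange_poly_def M_eq using fin12 disj by (rule sum.union_disjoint)
  finally have "lagrange_poly E x \<le> L0 + x u * x v * sum x B - (b + real n / 2) * (x u * (x w * x s))"
    using merged poly1 poly2 by (simp add: algebra_simps)
  also have "\<dots> < L0"
  proof -
    have "sum x B \<le> b * a"
      unfolding b_def using m(2) by (intro sum_bounded_above) (auto simp: a_def B_def A_def)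
    then have "x u * x v * sum x B \<le> x u * x w * (b * a)"
      using xpos ord m by (intro mult_mono) (auto simp: a_def b_def B_def A_def less_imp_le pos intro!: sum_nonneg)
    moreover have "b * a < (b + real n / 2) * x s"
    proof -
      have n4: "real n \<ge> 4" using n by simp
      \<comment> \<open>The quotient of \<open>b\<close> by b + n/2 increases with \<open>b\<close>;
        at b = n - 1 it is (2n-2)/(3n-2), the factor in \<open>s_large\<close>.\<close>
      have "b * real n \<le> (real n - 1) * real n" using bn by (intro mult_right_mono) auto
      then have "b \<le> (b + real n / 2) * (1 - real n / (3 * real n - 2))"
        using n4 by (simp add: field_simps)
      then have "b * a \<le> (b + real n / 2) * ((1 - real n / (3 * real n - 2)) * a)"
        using m(3) by (simp add: a_def)
      also have "\<dots> < (b + real n / 2) * x s"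
        using s_large n4 by (intro mult_strict_left_mono) (auto simp: b_def)
      finally show ?thesis .
    qed
    then have "x u * x w * (b * a) < x u * x w * ((b + real n / 2) * x s)"
      using xpos by (intro mult_strict_left_mono) auto
    ultimately show ?thesis by (simp add: algebra_simps)
  qed
  finally show False using L by simp
qed

end

section \<open>Case distinction on the size of the support\<close>

theorem theorem4:
  fixes m t :: nat and V :: "'a set" and E :: "'a set set"
  assumes "(t - 1) choose 3 \<le> m"
    and "real m \<le> real ((t - 1) choose 3) + real ((t - 2) choose 2) - (real t - 1) / 2"
    and "three_graph V E"
    and "card E = m"
    and "\<not> (\<exists>K. clique3 V E (t - 1) K)"
  shows "lagrangian V E < lagrangian {1..t - 1} ([{1..t - 1}]\<^bsup>3\<^esup>)"
proof -
  have t: "t \<ge> 5"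
  proof (rule ccontr)
    assume "\<not> ?thesis"
    \<comment> \<open>For t <= 1 truncated subtraction makes t - 1 = 0, and the empty set is a
      clique of order 0. For t = 2, 3 the upper bound on \<open>m\<close> is negative; for t = 4 it
      is 1/2 while 1 <= m.\<close>
    then consider "t = 0" | "t = 1" | "t = 2" | "t = 3" | "t = 4" by linarith
    then show False
    proof cases
      case 1
      then show ?thesis using assms(5) by (auto simp: clique3_def nsets_def)
    next
      case 2
      then show ?thesis using assms(5) by (auto simp: clique3_def nsets_def)
    next
      case 3
      then show ?thesis using assms(2) by (simp add: binomial_eq_0)
    next
      case 4
      then show ?thesis using assms(2) by (simp add: binomial_eq_0)
    next
      case 5
      then show ?thesis using assms(1,2) by simp
    qed
  qed
  define n where "n = t - 1"
  have n: "n \<ge> 4" using t by (simp add: n_def)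
  define L0 where "L0 = (real n - 1) * (real n - 2) / (6 * (real n)\<^sup>2)"
  have ch3: "real (n choose 3) = real n * (real n - 1) * (real n - 2) / 6"
    by (simp add: binomial_gbinomial gbinomial_prod_rev numeral_3_eq_3 field_simps)
  have "real (n - 1 choose 2) = (real n - 1) * (real n - 2) / 2"
    using n by (simp add: binomial_gbinomial gbinomial_prod_rev numeral_2_eq_2 field_simps of_nat_diff)
  moreover have "n - 1 = t - 2" by (simp add: n_def)
  ultimately have "real (t - 2 choose 2) = (real n - 1) * (real n - 2) / 2" by metis
  moreover have "real t = real n + 1" using t by (simp add: n_def)
  ultimately have m: "real m \<le> (real n - 1) * (real n - 2) * (real n + 3) / 6 - real n / 2"
    using assms(2) ch3 unfolding n_def[symmetric] by (simp add: field_simps)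

  have "L0 \<le> lagrangian {1..n} ([{1..n}]\<^bsup>3\<^esup>)"
  proof -
    define y where "y = (\<lambda>i :: nat. 1 / real n)"
    have "y \<in> weightings {1..n}" using n by (simp add: y_def weightings_def)
    moreover have "three_graph {1..n} ([{1..n}]\<^bsup>3\<^esup>)" "{1..n} \<noteq> {}"
      using n by (auto simp: three_graph_def)
    ultimately have "lagrange_poly ([{1..n}]\<^bsup>3\<^esup>) y \<le> lagrangian {1..n} ([{1..n}]\<^bsup>3\<^esup>)"
      using lagrangian_attained by metis
    moreover have "lagrange_poly ([{1..n}]\<^bsup>3\<^esup>) y = (\<Sum>e\<in>[{1..n}]\<^bsup>3\<^esup>. (1 / real n) ^ 3)"
      unfolding lagrange_poly_def by (intro sum.cong) (auto simp: y_def nsets_def)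
    moreover have "card ([{1..n}]\<^bsup>3\<^esup>) = n choose 3" by simp
    moreover have "real (n choose 3) * (1 / real n) ^ 3 = L0"
      using n unfolding ch3 L0_def by (simp add: power2_eq_square power3_eq_cube)
    ultimately show ?thesis by simp
  qed
  moreover have "lagrangian V E < L0"
  proof -
    have finV: "finite V" and E: "E \<subseteq> [V]\<^bsup>3\<^esup>" using assms(3) by (auto simp: three_graph_def)
    have fE: "finite E" using finV E finite_imp_finite_nsets finite_subset by metis
    \<comment> \<open>An edge exists, so \<open>V\<close> is nonempty and its Lagrangian is an
      attained maximum.\<close>
    have "n choose 3 > 0" using n by (intro zero_less_binomial) simp
    then have "m > 0" using assms(1) unfolding n_def[symmetric] by linarith
    then have "E \<noteq> {}" using assms(4) by auto
    then have "V \<noteq> {}" using E by (auto simp: nsets_empty_iff)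
    then obtain S x where S: "S \<subseteq> V" and st: "stationary_weighting S {e \<in> E. e \<subseteq> S} x"
      and L: "lagrange_poly {e \<in> E. e \<subseteq> S} x = lagrangian V E"
      using lagrangian_stationary[OF assms(3)] by metis
    interpret stationary_weighting S "{e \<in> E. e \<subseteq> S}" x by (rule st)
    have "card {e \<in> E. e \<subseteq> S} \<le> m" unfolding assms(4)[symmetric] using fE by (intro card_mono) auto
    then have cE: "real (card {e \<in> E. e \<subseteq> S})
        \<le> (real n - 1) * (real n - 2) * (real n + 3) / 6 - real n / 2"
      using m by linarith
    consider "card S < n" | "card S = n" | "card S = n + 1" | "card S \<ge> n + 2" by linarith
    then have "lagrange_poly {e \<in> E. e \<subseteq> S} x < L0"
    proof cases
      case 1
      have "card S \<ge> 1" using nonempty fin by (simp add: Suc_le_eq card_gt_0_iff)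
      then show ?thesis
        using lagrange_poly_le_complete complete_lagrangian_value_strict_mono[of "card S" n] 1 n
        by (simp add: L0_def)
    next
      case 2
      \<comment> \<open>\<open>S\<close> has order t - 1, so it misses a triple; as all its weights
        are positive, the loss is strict.\<close>
      have "\<not> clique3 V E n S" using assms(5) by (auto simp: n_def)
      then obtain f where f: "f \<in> [S]\<^bsup>3\<^esup>" "f \<notin> E"
        using S 2 fin by (auto simp: clique3_def nsets_def)
      have "lagrange_poly {e \<in> E. e \<subseteq> S} x < lagrange_poly ([S]\<^bsup>3\<^esup>) x"
        unfolding lagrange_poly_def
      proof (rule sum_strict_mono2[OF finite_imp_finite_nsets[OF fin] edges, of f])
        show "0 < prod x f" using f pos by (intro prod_pos) (auto simp: nsets_def)
        show "0 \<le> prod x e" if "e \<in> [S]\<^bsup>3\<^esup>" for e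
          using that pos by (intro prod_nonneg) (auto simp: nsets_def less_imp_le)
      qed (use f in auto)
      also have "\<dots> \<le> L0"
        unfolding L0_def using fin 2 n sum1 pos
        by (intro lagrange_poly_complete_le) (auto simp: weightings_def less_imp_le)
      finally show ?thesis .
    next
      case 3
      then show ?thesis using lagrange_poly_less_if_card_Suc[OF n] cE by (simp add: L0_def)
    next
      case 4
      then show ?thesis using lagrange_poly_less_if_card_ge[OF n] cE by (simp add: L0_def)
    qed
    then show ?thesis using L by simp
  qed
  ultimately show ?thesis by (simp add: n_def)
qed

end
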